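(* Let $k \geq 2$. Suppose a $k$-graph $F$ is a core and its $2$-shadow contains a clique of size $k+1$. Then the $F$-removal lemma is not polynomial.
   Context: A $k$-graph is a finite $k$-uniform hypergraph $F=(V(F),E(F))$; $v(F)=|V(F)|$. A homomorphism from a $k$-graph $F_1$ to a $k$-graph $F_2$ is a map $\varphi:V(F_1)\to V(F_2)$ such that $\{\varphi(x):x\in e\}\in E(F_2)$ for every $e\in E(F_1)$. The core of $F$ is the smallest (with respect to the number of vertices) subgraph of $F$ to which there is a homomorphism from $F$. $F$ is a core if it is the core of itself, i.e. there is no homomorphism from $F$ to a subgraph $F_0$ of $F$ with $V(F_0)\subsetneq V(F)$. The $2$-shadow of $F$ is the graph on vertex set $V(F)$ in which $\{u,v\}$ ($u \neq v$) is an edge if and only if $u,v$ both belong to some $e\in E(F)$. A copy of $F$ in a $k$-graph $G$ is a (not necessarily induced) subgraph of $G$ isomorphic to $F$. Copies are edge-disjoint if no two of them share an edge. The $F$-removal lemma is polynomial if there are constants $c,C>0$ depending only on $F$ such that for every $\varepsilon\in(0,1)$ and every $n \geq 1$, every $n$-vertex $k$-graph with at least $\varepsilon n^k$ pairwise edge-disjoint copies of $F$ contains at least $c\,\varepsilon^{C} n^{v(F)}$ copies of $F$. *)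

theory Defs
  imports Complex_Main
begin

text \<open>A hypergraph is a pair of a vertex set and an edge set.\<close>

type_synonym 'a hgraph = "'a set \<times> 'a set set"

abbreviation verts :: "'a hgraph \<Rightarrow> 'a set" where
  "verts \<equiv> fst"

abbreviation edges :: "'a hgraph \<Rightarrow> 'a set set" where
  "edges \<equiv> snd"

definition k_graph :: "nat \<Rightarrow> 'a hgraph \<Rightarrow> bool" where
  "k_graph k F \<longleftrightarrow> finite (verts F) \<and> (\<forall>e\<in>edges F. e \<subseteq> verts F \<and> card e = k)"

definition subhgraph :: "'a hgraph \<Rightarrow> 'a hgraph \<Rightarrow> bool" where
  "subhgraph H G \<longleftrightarrow>
     verts H \<subseteq> verts G \<and> edges H \<subseteq> edges G \<and> (\<forall>e\<in>edges H. e \<subseteq> verts H)"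

definition hgraph_hom :: "('a \<Rightarrow> 'b) \<Rightarrow> 'a hgraph \<Rightarrow> 'b hgraph \<Rightarrow> bool" where
  "hgraph_hom \<phi> F G \<longleftrightarrow> \<phi> ` verts F \<subseteq> verts G \<and> (\<forall>e\<in>edges F. \<phi> ` e \<in> edges G)"

definition is_core :: "'a hgraph \<Rightarrow> bool" where
  "is_core F \<longleftrightarrow>
     \<not> (\<exists>F0 \<phi>. subhgraph F0 F \<and> verts F0 \<subset> verts F \<and> hgraph_hom \<phi> F F0)"

definition two_shadow :: "'a hgraph \<Rightarrow> 'a hgraph" where
  "two_shadow F = (verts F, {{u, v} | u v. u \<noteq> v \<and> (\<exists>e\<in>edges F. u \<in> e \<and> v \<in> e)})"

definition is_clique :: "'a set \<Rightarrow> 'a hgraph \<Rightarrow> bool" where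
  "is_clique K G \<longleftrightarrow> K \<subseteq> verts G \<and> (\<forall>u\<in>K. \<forall>v\<in>K. u \<noteq> v \<longrightarrow> {u, v} \<in> edges G)"

definition hgraph_iso :: "'a hgraph \<Rightarrow> 'b hgraph \<Rightarrow> bool" where
  "hgraph_iso F H \<longleftrightarrow>
     (\<exists>f. bij_betw f (verts F) (verts H) \<and> edges H = (\<lambda>e. f ` e) ` edges F)"

text \<open>Copies are unlabelled: a copy is a subgraph, not an embedding.\<close>

definition copies :: "'a hgraph \<Rightarrow> 'b hgraph \<Rightarrow> 'b hgraph set" where
  "copies F G = {H. subhgraph H G \<and> hgraph_iso F H}"

definition edge_disjoint :: "'a hgraph set \<Rightarrow> bool" where
  "edge_disjoint S \<longleftrightarrow> pairwise (\<lambda>H H'. edges H \<inter> edges H' = {}) S"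

text \<open>
  A type cannot be quantified inside a definition, so the host graphs \<open>G\<close> have natural numbers
  as vertices. Every finite hypergraph is isomorphic to such a graph.
\<close>

definition polynomial_removal :: "nat \<Rightarrow> 'a hgraph \<Rightarrow> bool" where
  "polynomial_removal k F \<longleftrightarrow>
     (\<exists>c C :: real. c > 0 \<and> C > 0 \<and>
       (\<forall>(\<epsilon> :: real) (n :: nat) (G :: nat hgraph).
          0 < \<epsilon> \<and> \<epsilon> < 1 \<and> n \<ge> 1 \<and> k_graph k G \<and> card (verts G) = n \<and>
          (\<exists>S \<subseteq> copies F G. edge_disjoint S \<and> real (card S) \<ge> \<epsilon> * real n ^ k)
          \<longrightarrow> real (card (copies F G)) \<ge> c * \<epsilon> powr C * real n ^ card (verts F)))"

end

theory Submission
  imports Defs "HOL-Library.FuncSet" "HOL-Real_Asymp.Real_Asymp"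
begin

text \<open>
  Number the vertices of \<open>F\<close> and evaluate polynomials of degree less than \<open>k\<close> with coefficient
  vectors in \<open>{0..<d}\<^sup>d\<close> there: any \<open>k\<close> values determine the polynomial, while any \<open>k + 1\<close> values
  satisfy an affine dependence given by a divided difference. Pigeonhole the polynomials by the
  squared distances between their values on the clique \<open>K\<close>; this only costs a factor polynomial
  in \<open>d\<close>. The host is the union of the copies of \<open>F\<close> traced out by the surviving polynomials.
  These copies are edge-disjoint. Conversely, as \<open>F\<close> is a core, every copy picks one point above
  each vertex of \<open>F\<close>, and any two of its points above \<open>K\<close> lie in an edge of the host, so they have
  the prescribed distance. Since the distances force the affine dependence, the
  point above one vertex of \<open>K\<close> is determined by the others. Hence the number of copies falls
  short of the trivial bound by a factor \<open>d\<^sup>d\<close>, whereas \<open>1 / \<epsilon>\<close> is only exponential in \<open>d\<close>.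
\<close>

section \<open>Images of hypergraphs and transfer of host graphs\<close>

definition hgraph_image :: "('a \<Rightarrow> 'b) \<Rightarrow> 'a hgraph \<Rightarrow> 'b hgraph" where
  "hgraph_image f G = (f ` verts G, image f ` edges G)"

lemma hgraph_image_id:
  assumes "subhgraph H G" "\<And>v. v \<in> verts G \<Longrightarrow> f v = v"
  shows "hgraph_image f H = H"
proof -
  have id: "f ` e = e" if "e \<subseteq> verts G" for e
    using assms(2) that by (simp add: subset_iff)
  have "e \<subseteq> verts G" if "e \<in> edges H" for e
    using that assms(1) unfolding subhgraph_def by blast
  then have "image f ` edges H = id ` edges H"
    using id by (intro image_cong) simp_all
  moreover have "f ` verts H = verts H" using id assms(1) by (simp add: subhgraph_def)
  ultimately show ?thesis by (simp add: hgraph_image_def)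
qed

lemma hgraph_image_comp: "hgraph_image g (hgraph_image f H) = hgraph_image (g \<circ> f) H"
  by (simp add: hgraph_image_def image_comp comp_def)

lemma hgraph_iso_image:
  "inj_on f (verts H) \<Longrightarrow> hgraph_iso H (hgraph_image f H)"
  unfolding hgraph_iso_def hgraph_image_def by (intro exI[of _ f]) (auto simp: bij_betw_def)

lemma hgraph_iso_trans:
  assumes "hgraph_iso F H" "hgraph_iso H H'" shows "hgraph_iso F H'"
proof -
  obtain f g where f: "bij_betw f (verts F) (verts H)" "edges H = image f ` edges F"
    and g: "bij_betw g (verts H) (verts H')" "edges H' = image g ` edges H"
    using assms unfolding hgraph_iso_def by (elim exE conjE)
  have "edges H' = image (g \<circ> f) ` edges F"
    unfolding g(2) f(2) by (simp add: image_comp comp_def)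
  then show ?thesis
    unfolding hgraph_iso_def using bij_betw_trans[OF f(1) g(1)] by (intro exI conjI)
qed

lemma k_graph_subhgraph_refl: "k_graph k G \<Longrightarrow> subhgraph G G"
  by (auto simp: k_graph_def subhgraph_def)

lemma k_graph_image:
  assumes "k_graph k G" "inj_on f (verts G)"
  shows "k_graph k (hgraph_image f G)"
  using assms unfolding k_graph_def hgraph_image_def
  by (auto simp: card_image inj_on_subset)

lemma finite_copies:
  assumes "finite (verts G)" shows "finite (copies F G)"
proof (rule finite_subset)
  show "copies F G \<subseteq> Pow (verts G) \<times> Pow (Pow (verts G))"
  proof
    fix H assume "H \<in> copies F G"
    then have "verts H \<subseteq> verts G" "\<forall>e\<in>edges H. e \<subseteq> verts H"
      by (simp_all add: copies_def subhgraph_def)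
    then show "H \<in> Pow (verts G) \<times> Pow (Pow (verts G))"
      by (simp add: mem_Times_iff) blast
  qed
qed (use assms in auto)

lemma copies_image:
  assumes "inj_on f (verts G)" "H \<in> copies F G"
  shows "hgraph_image f H \<in> copies F (hgraph_image f G)"
proof -
  have H: "subhgraph H G" "hgraph_iso F H" using assms(2) by (auto simp: copies_def)
  then have "inj_on f (verts H)" using assms(1) inj_on_subset by (simp add: subhgraph_def) blast
  then have "hgraph_iso F (hgraph_image f H)"
    by (rule hgraph_iso_trans[OF H(2) hgraph_iso_image])
  moreover have "subhgraph (hgraph_image f H) (hgraph_image f G)"
    using H(1) unfolding subhgraph_def hgraph_image_def by (simp add: image_mono)
  ultimately show ?thesis unfolding copies_def by blast
qed

lemma hgraph_image_inv:
  assumes "inj_on f (verts G)" "subhgraph H G"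
  shows "hgraph_image (inv_into (verts G) f) (hgraph_image f H) = H"
proof -
  have "hgraph_image (inv_into (verts G) f \<circ> f) H = H"
    by (rule hgraph_image_id[OF assms(2)]) (simp add: assms(1))
  then show ?thesis by (simp only: hgraph_image_comp)
qed

lemma inj_on_hgraph_image:
  assumes "inj_on f (verts G)"
  shows "inj_on (hgraph_image f) (copies F G)"
proof (rule inj_on_inverseI)
  fix H assume "H \<in> copies F G"
  then show "hgraph_image (inv_into (verts G) f) (hgraph_image f H) = H"
    using hgraph_image_inv[OF assms] by (simp add: copies_def)
qed

text \<open>The inverse of \<open>f\<close> carries the image back to \<open>G\<close>, so copies
  pull back injectively. This lets a lower bound on the copies in the image pass to
  \<open>G\<close>.\<close>

lemma card_copies_image_le:
  assumes "k_graph k G" "inj_on f (verts G)"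
  shows "card (copies F (hgraph_image f G)) \<le> card (copies F G)"
proof (rule card_inj_on_le)
  let ?g = "inv_into (verts G) f"
  have inj: "inj_on ?g (verts (hgraph_image f G))"
    by (simp add: hgraph_image_def inj_on_inv_into)
  show "inj_on (hgraph_image ?g) (copies F (hgraph_image f G))"
    by (rule inj_on_hgraph_image[OF inj])
  show "hgraph_image ?g ` copies F (hgraph_image f G) \<subseteq> copies F G"
    using copies_image[OF inj, of _ F]
      hgraph_image_inv[OF assms(2) k_graph_subhgraph_refl[OF assms(1)]] by auto
  show "finite (copies F G)" using assms by (simp add: finite_copies k_graph_def)
qed

lemma edge_disjoint_image:
  assumes "inj_on f (verts G)" "S \<subseteq> copies F G" "edge_disjoint S"
  shows "edge_disjoint (hgraph_image f ` S)"
  unfolding edge_disjoint_def pairwise_def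
proof (intro ballI impI)
  fix A B assume "A \<in> hgraph_image f ` S" "B \<in> hgraph_image f ` S" "A \<noteq> B"
  then obtain H H' where H: "H \<in> S" "H' \<in> S" "H \<noteq> H'" "A = hgraph_image f H" "B = hgraph_image f H'"
    by blast
  then have "edges H \<inter> edges H' = {}"
    using assms(3) unfolding edge_disjoint_def pairwise_def by blast
  moreover have "edges H \<subseteq> Pow (verts G)" "edges H' \<subseteq> Pow (verts G)"
    using H(1,2) assms(2) unfolding copies_def subhgraph_def by blast+
  then have "image f ` edges H \<inter> image f ` edges H' = image f ` (edges H \<inter> edges H')"
    by (intro inj_on_image_Int[OF inj_on_image_Pow[OF assms(1)], symmetric])
  ultimately show "edges A \<inter> edges B = {}" using H by (simp add: hgraph_image_def)
qed

text \<open>Hosts in the definition live on natural numbers, whereas the host built below has pairs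
  of a vertex and a point as vertices. Numbering a finite host carries edge-disjoint copies forward
  and the lower bound on the count back, with constants common to all hosts.\<close>

lemma polynomial_removal_host:
  fixes F :: "'a hgraph"
  assumes "polynomial_removal k F"
  obtains c C :: real where "c > 0" "C > 0"
    "\<And>(\<epsilon> :: real) (G :: 'b hgraph) S. 0 < \<epsilon> \<Longrightarrow> \<epsilon> < 1 \<Longrightarrow> k_graph k G \<Longrightarrow> verts G \<noteq> {} \<Longrightarrow>
       S \<subseteq> copies F G \<Longrightarrow> edge_disjoint S \<Longrightarrow> \<epsilon> * real (card (verts G)) ^ k \<le> real (card S) \<Longrightarrow>
       c * \<epsilon> powr C * real (card (verts G)) ^ card (verts F) \<le> real (card (copies F G))"
proof -
  obtain c C :: real where cC: "c > 0" "C > 0" and *: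
    "\<And>(\<epsilon> :: real) (n :: nat) (G :: nat hgraph).
          0 < \<epsilon> \<and> \<epsilon> < 1 \<and> n \<ge> 1 \<and> k_graph k G \<and> card (verts G) = n \<and>
          (\<exists>S \<subseteq> copies F G. edge_disjoint S \<and> real (card S) \<ge> \<epsilon> * real n ^ k)
          \<Longrightarrow> real (card (copies F G)) \<ge> c * \<epsilon> powr C * real n ^ card (verts F)"
    using assms unfolding polynomial_removal_def by blast
  show ?thesis
  proof (rule that[OF cC])
    fix \<epsilon> :: real and G :: "'b hgraph" and S
    assume \<epsilon>: "0 < \<epsilon>" "\<epsilon> < 1" and G: "k_graph k G" "verts G \<noteq> {}"
      and S: "S \<subseteq> copies F G" "edge_disjoint S" "\<epsilon> * real (card (verts G)) ^ k \<le> real (card S)"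
    have fin: "finite (verts G)" using G by (simp add: k_graph_def)
    then obtain f :: "'b \<Rightarrow> nat" where f: "inj_on f (verts G)"
      using finite_imp_inj_to_nat_seg by blast
    let ?G = "hgraph_image f G"
    have n: "card (verts ?G) = card (verts G)"
      using f by (simp add: hgraph_image_def card_image)
    have "card (hgraph_image f ` S) = card S"
      using inj_on_hgraph_image[OF f] S(1) by (intro card_image) (rule inj_on_subset)
    moreover have "hgraph_image f ` S \<subseteq> copies F ?G" using S(1) copies_image[OF f] by blast
    ultimately have "\<exists>S \<subseteq> copies F ?G. edge_disjoint S \<and>
        real (card S) \<ge> \<epsilon> * real (card (verts G)) ^ k"
      using edge_disjoint_image[OF f S(1,2)] S(3) by (intro exI[of _ "hgraph_image f ` S"]) simp
    then have "real (card (copies F ?G)) \<ge> c * \<epsilon> powr C * real (card (verts G)) ^ card (verts F)"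
      using \<epsilon> G fin n k_graph_image[OF G(1) f] by (intro *) (auto simp: Suc_le_eq card_gt_0_iff)
    also have "real (card (copies F ?G)) \<le> real (card (copies F G))"
      using card_copies_image_le[OF G(1) f] by simp
    finally show "c * \<epsilon> powr C * real (card (verts G)) ^ card (verts F) \<le> real (card (copies F G))" .
  qed
qed

section \<open>Lifts of a core\<close>

text \<open>If \<open>\<phi>\<close> were not onto, its image would be a subgraph on fewer vertices
  to which \<open>F\<close> maps, contrary to the core property. Finiteness turns surjectivity into
  bijectivity, and an injective self-map of the finite edge set is onto.\<close>

lemma core_endomorphism:
  assumes F: "k_graph k F" and core: "is_core F" and \<phi>: "hgraph_hom \<phi> F F"
  shows "bij_betw \<phi> (verts F) (verts F)" "image \<phi> ` edges F = edges F"
proof -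
  have fin: "finite (verts F)" and E: "edges F \<subseteq> Pow (verts F)" using F by (auto simp: k_graph_def)
  have sub: "\<phi> ` verts F \<subseteq> verts F" and hom: "\<And>e. e \<in> edges F \<Longrightarrow> \<phi> ` e \<in> edges F"
    using \<phi> by (auto simp: hgraph_hom_def)
  have surj: "\<phi> ` verts F = verts F"
  proof (rule ccontr)
    assume "\<phi> ` verts F \<noteq> verts F"
    let ?F0 = "hgraph_image \<phi> F"
    have "subhgraph ?F0 F" "verts ?F0 \<subset> verts F" "hgraph_hom \<phi> F ?F0"
      using sub hom E \<open>\<phi> ` verts F \<noteq> verts F\<close>
      by (simp_all add: subhgraph_def hgraph_image_def hgraph_hom_def) blast+
    then show False using core unfolding is_core_def by blast
  qed
  then show bij: "bij_betw \<phi> (verts F) (verts F)"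
    using eq_card_imp_inj_on[OF fin, of \<phi>] by (simp add: bij_betw_def)
  have "inj_on (image \<phi>) (edges F)"
    using bij E by (auto simp: bij_betw_def intro: inj_on_subset[OF inj_on_image_Pow])
  moreover have "finite (edges F)" using fin E by (auto intro: finite_subset)
  ultimately show "image \<phi> ` edges F = edges F"
    using hom by (intro endo_inj_surj) auto
qed

text \<open>The graph of \<open>y\<close> over \<open>F\<close>. Keeping \<open>v\<close> as first
  coordinate makes every lift a copy of \<open>F\<close>, whether or not \<open>y\<close> is
  injective.\<close>

definition lift_along :: "('a \<Rightarrow> 'b) \<Rightarrow> 'a hgraph \<Rightarrow> ('a \<times> 'b) hgraph" where
  "lift_along y F = hgraph_image (\<lambda>v. (v, y v)) F"

text \<open>The vertex set is the whole product, so its size does not depend on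
  \<open>T\<close>.\<close>

definition lift_union :: "'a hgraph \<Rightarrow> 'b set \<Rightarrow> ('a \<Rightarrow> 'b) set \<Rightarrow> ('a \<times> 'b) hgraph" where
  "lift_union F B T = (verts F \<times> B, \<Union>x\<in>T. edges (lift_along x F))"

lemma k_graph_lift_union:
  assumes "k_graph k F" "finite B" "\<And>x v. x \<in> T \<Longrightarrow> v \<in> verts F \<Longrightarrow> x v \<in> B"
  shows "k_graph k (lift_union F B T)"
  using assms unfolding k_graph_def lift_union_def lift_along_def hgraph_image_def
  by (auto simp: card_image inj_on_def)

lemma lift_along_copy:
  assumes "k_graph k F" "\<And>x v. x \<in> T \<Longrightarrow> v \<in> verts F \<Longrightarrow> x v \<in> B" "x \<in> T"
  shows "lift_along x F \<in> copies F (lift_union F B T)"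
proof -
  have "hgraph_iso F (lift_along x F)"
    unfolding lift_along_def by (intro hgraph_iso_image) (auto simp: inj_on_def)
  moreover have "subhgraph (lift_along x F) (lift_union F B T)"
    using assms unfolding subhgraph_def lift_union_def lift_along_def hgraph_image_def k_graph_def
    by (simp, blast)
  ultimately show ?thesis by (simp add: copies_def)
qed

lemma lift_edge_eqD:
  assumes "(\<lambda>v. (v, x v)) ` e = (\<lambda>v. (v, y v)) ` e'"
  shows "e = e'" "\<And>v. v \<in> e \<Longrightarrow> x v = y v"
proof -
  have "fst ` (\<lambda>v. (v, x v)) ` e = fst ` (\<lambda>v. (v, y v)) ` e'" using assms by simp
  then show e: "e = e'" by (simp add: image_comp)
  show "x v = y v" if "v \<in> e" for v
  proof -
    have "(v, x v) \<in> (\<lambda>v. (v, y v)) ` e'" using assms that by blast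
    then show ?thesis by auto
  qed
qed

text \<open>Projecting a copy to \<open>F\<close> gives an endomorphism, hence an automorphism
  because \<open>F\<close> is a core; relabelling by its inverse exhibits the copy as a lift.
  Different edges may stem from different members of \<open>T\<close>, so agreement with a member of
  \<open>T\<close> holds one edge at a time.\<close>

lemma copies_lift_unionE:
  assumes F: "k_graph k F" and core: "is_core F" and H: "H \<in> copies F (lift_union F B T)"
  obtains y where "y \<in> verts F \<rightarrow>\<^sub>E B" "H = lift_along y F"
    "\<And>e. e \<in> edges F \<Longrightarrow> \<exists>x\<in>T. \<forall>v\<in>e. y v = x v"
proof -
  obtain g where g: "bij_betw g (verts F) (verts H)" "edges H = image g ` edges F"
    and sub: "subhgraph H (lift_union F B T)"
    using H unfolding copies_def hgraph_iso_def mem_Collect_eq by (elim exE conjE)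
  have gV: "g ` verts F = verts H" using g by (simp add: bij_betw_def)
  define \<sigma> where "\<sigma> = fst \<circ> g"
  have edge: "\<exists>x\<in>T. \<exists>e'\<in>edges F. g ` e = (\<lambda>v. (v, x v)) ` e'" if "e \<in> edges F" for e
  proof -
    have "g ` e \<in> edges (lift_union F B T)" using that g sub by (auto simp: subhgraph_def)
    then show ?thesis by (auto simp: lift_union_def lift_along_def hgraph_image_def)
  qed
  have \<sigma>_image: "\<sigma> ` e = e'" if "g ` e = (\<lambda>v. (v, x v)) ` e'" for e e' and x :: "'a \<Rightarrow> 'b"
    unfolding \<sigma>_def image_comp[symmetric] that by (simp add: image_comp)
  have "hgraph_hom \<sigma> F F"
    unfolding hgraph_hom_def
  proof (intro conjI ballI)
    show "\<sigma> ` verts F \<subseteq> verts F"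
    proof -
      have "verts H \<subseteq> verts F \<times> B" using sub by (simp add: subhgraph_def lift_union_def)
      then have "fst ` verts H \<subseteq> verts F" by auto
      then show ?thesis unfolding gV[symmetric] \<sigma>_def image_comp .
    qed
    show "\<sigma> ` e \<in> edges F" if e: "e \<in> edges F" for e
    proof -
      obtain x e' where "e' \<in> edges F" "g ` e = (\<lambda>v. (v, x v)) ` e'"
        using edge[OF e] by blast
      then show ?thesis using \<sigma>_image by simp
    qed
  qed
  note \<sigma> = core_endomorphism[OF F core this]
  define \<tau> where "\<tau> = inv_into (verts F) \<sigma>"
  have \<tau>: "\<tau> v \<in> verts F" "\<sigma> (\<tau> v) = v" if "v \<in> verts F" for v
    using \<sigma>(1) that by (auto simp: \<tau>_def bij_betw_def inv_into_into f_inv_into_f)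
  have \<tau>\<sigma>: "\<tau> (\<sigma> v) = v" if "v \<in> verts F" for v
    using \<sigma>(1) that by (simp add: \<tau>_def bij_betw_def)
  \<comment> \<open>After relabelling by \<open>\<tau>\<close>, the point belonging to
    \<open>v\<close> lies above \<open>v\<close>, and \<open>y v\<close> is its second
    coordinate.\<close>
  define y where "y = (\<lambda>v\<in>verts F. snd (g (\<tau> v)))"
  have g_eq: "g v = (\<sigma> v, y (\<sigma> v))" if "v \<in> verts F" for v
  proof -
    have "\<sigma> v \<in> verts F" using \<sigma>(1) that by (auto simp: bij_betw_def)
    then have "y (\<sigma> v) = snd (g v)" using \<tau>\<sigma>[OF that] by (simp add: y_def)
    then show ?thesis by (simp add: \<sigma>_def)
  qed
  have g_image: "g ` A = (\<lambda>v. (v, y v)) ` \<sigma> ` A" if "A \<subseteq> verts F" for A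
    unfolding image_comp using that g_eq by (intro image_cong) auto
  have E: "e \<subseteq> verts F" if "e \<in> edges F" for e using F that by (auto simp: k_graph_def)
  show ?thesis
  proof (rule that)
    have "g (\<tau> v) \<in> verts F \<times> B" if "v \<in> verts F" for v
      using \<tau>(1)[OF that] gV sub by (auto simp: subhgraph_def lift_union_def)
    then show "y \<in> verts F \<rightarrow>\<^sub>E B" by (auto simp: y_def PiE_iff mem_Times_iff)
    have "verts H = (\<lambda>v. (v, y v)) ` verts F"
      using gV g_image[of "verts F"] \<sigma>(1) by (simp add: bij_betw_def)
    moreover have "edges H = image (\<lambda>v. (v, y v)) ` edges F"
    proof -
      have "edges H = (\<lambda>e. (\<lambda>v. (v, y v)) ` \<sigma> ` e) ` edges F"
        unfolding g(2) by (intro image_cong refl g_image E)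
      also have "\<dots> = image (\<lambda>v. (v, y v)) ` image \<sigma> ` edges F" by (simp add: image_comp comp_def)
      finally show ?thesis unfolding \<sigma>(2) .
    qed
    ultimately show "H = lift_along y F" by (simp add: lift_along_def hgraph_image_def prod_eq_iff)
    show "\<exists>x\<in>T. \<forall>v\<in>e. y v = x v" if "e \<in> edges F" for e
    proof -
      have "e \<in> image \<sigma> ` edges F" using \<sigma>(2) that by simp
      then obtain e0 where e0: "e0 \<in> edges F" "e = \<sigma> ` e0" by (elim imageE)
      obtain x e' where x: "x \<in> T" "g ` e0 = (\<lambda>v. (v, x v)) ` e'" using edge[OF e0(1)] by blast
      have "(\<lambda>v. (v, y v)) ` e = (\<lambda>v. (v, x v)) ` e'"
        using x(2) g_image[OF E[OF e0(1)]] e0(2) by simp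
      from lift_edge_eqD(2)[OF this] x(1) show ?thesis by blast
    qed
  qed
qed

section \<open>Affine dependences and distances\<close>

text \<open>The weights of the divided difference at \<open>k + 1\<close> distinct points serve as
  \<open>c\<close>, since it annihilates all polynomials of degree less than
  \<open>k\<close>.\<close>

lemma moment_relation:
  fixes P :: "real set"
  assumes "finite P" "card P = Suc k"
  shows "\<exists>c. (\<exists>t\<in>P. c t \<noteq> 0) \<and> (\<forall>j<k. (\<Sum>t\<in>P. c t * t ^ j) = 0)"
  using assms
proof (induction k arbitrary: P)
  case 0
  then have "P \<noteq> {}" by auto
  then show ?case by (intro exI[of _ "\<lambda>_. 1"]) auto
next
  case (Suc k)
  then obtain s Q where P: "P = insert s Q" "s \<notin> Q" "card Q = Suc k" "finite Q"
    by (metis card_Suc_eq finite_insert)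
  from Suc.IH[OF P(4,3)] obtain c t0 where
    c: "\<forall>j<k. (\<Sum>t\<in>Q. c t * t ^ j) = 0" and t0: "t0 \<in> Q" "c t0 \<noteq> 0" by blast
  \<comment> \<open>the recursion of divided differences\<close>
  define c' where "c' t = (if t = s then - (\<Sum>t\<in>Q. c t / (t - s)) else c t / (t - s))" for t
  have "(\<Sum>t\<in>P. c' t * t ^ j) = 0" if j: "j < Suc k" for j
  proof -
    have "(\<Sum>t\<in>P. c' t * t ^ j) = c' s * s ^ j + (\<Sum>t\<in>Q. c t / (t - s) * t ^ j)"
      using P by (simp add: c'_def cong: sum.cong) (auto intro!: sum.cong)
    \<comment> \<open>The weight at \<open>s\<close> turns \<open>t ^ j\<close> into
      \<open>t ^ j - s ^ j\<close>. Dividing by \<open>t - s\<close> then leaves powers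
      \<open>t ^ i\<close> with \<open>i < j \<le> k\<close>, whose moments vanish by
      induction.\<close>
    also have "\<dots> = (\<Sum>t\<in>Q. c t / (t - s) * (t ^ j - s ^ j))"
      by (simp add: c'_def sum_subtractf algebra_simps sum_distrib_left)
    also have "\<dots> = (\<Sum>t\<in>Q. \<Sum>i<j. s ^ (j - Suc i) * (c t * t ^ i))"
    proof (rule sum.cong)
      fix t assume "t \<in> Q"
      then have "t - s \<noteq> 0" using P by auto
      then show "c t / (t - s) * (t ^ j - s ^ j) = (\<Sum>i<j. s ^ (j - Suc i) * (c t * t ^ i))"
        by (simp add: power_diff_sumr2[of t j s] sum_distrib_left mult_ac)
    qed simp
    also have "\<dots> = (\<Sum>i<j. s ^ (j - Suc i) * (\<Sum>t\<in>Q. c t * t ^ i))"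
      by (subst sum.swap) (simp add: sum_distrib_left)
    also have "\<dots> = 0" using c j by (intro sum.neutral) auto
    finally show ?thesis .
  qed
  moreover have "c' t0 \<noteq> 0" "t0 \<in> P" using t0 P by (auto simp: c'_def)
  ultimately show ?case by blast
qed

text \<open>On expanding the square, the two pure terms carry a factor
  \<open>\<Sum>v\<in>K. c v\<close>, which is zero; only the cross term survives.\<close>

lemma sum_weighted_sqdiff:
  fixes c y :: "'a \<Rightarrow> real"
  assumes "(\<Sum>v\<in>K. c v) = 0"
  shows "(\<Sum>u\<in>K. \<Sum>v\<in>K. c u * c v * (y u - y v)\<^sup>2) = - 2 * (\<Sum>v\<in>K. c v * y v)\<^sup>2"
proof -
  have "(\<Sum>u\<in>K. \<Sum>v\<in>K. c u * c v * (y u - y v)\<^sup>2) =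
      (\<Sum>u\<in>K. \<Sum>v\<in>K. c u * (y u)\<^sup>2 * c v + c u * (c v * (y v)\<^sup>2)
        - 2 * ((c u * y u) * (c v * y v)))"
    by (intro sum.cong refl) (simp add: power2_eq_square algebra_simps)
  also have "\<dots> = - 2 * (\<Sum>u\<in>K. \<Sum>v\<in>K. (c u * y u) * (c v * y v))"
    using assms
    by (simp add: sum.distrib sum_subtractf flip: sum_distrib_left sum_distrib_right)
  finally show ?thesis
    by (simp add: power2_eq_square sum_product)
qed

text \<open>Integer values avoid truncated subtraction and leave finitely many possible distances in
  a box, as the pigeonhole argument requires.\<close>

definition sqdist :: "nat \<Rightarrow> (nat \<Rightarrow> nat) \<Rightarrow> (nat \<Rightarrow> nat) \<Rightarrow> int" where
  "sqdist d y z = (\<Sum>i<d. (int (y i) - int (z i))\<^sup>2)"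

lemma sqdist_bounds:
  assumes "y \<in> {..<d} \<rightarrow>\<^sub>E {..<m}" "z \<in> {..<d} \<rightarrow>\<^sub>E {..<m}"
  shows "sqdist d y z \<in> {0..int (d * m\<^sup>2)}"
proof -
  have "(int (y i) - int (z i))\<^sup>2 \<le> (int m)\<^sup>2" if "i < d" for i
  proof -
    have "\<bar>int (y i) - int (z i)\<bar> \<le> int m" using PiE_mem[OF assms(1), of i] PiE_mem[OF assms(2), of i] that by simp
    then show ?thesis by (metis abs_le_square_iff abs_of_nat)
  qed
  then have "sqdist d y z \<le> (\<Sum>i<d. (int m)\<^sup>2)"
    unfolding sqdist_def by (intro sum_mono) auto
  then show ?thesis by (auto simp: sqdist_def sum_nonneg)
qed

text \<open>Pairwise distances determine whether points satisfy an affine dependence, because the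
  squared norm of an affine combination with weights summing to zero is a combination of them.\<close>

lemma affine_relation_transfer:
  fixes c :: "'a \<Rightarrow> real" and x y :: "'a \<Rightarrow> nat \<Rightarrow> nat"
  assumes c: "(\<Sum>v\<in>K. c v) = 0"
    and dist: "\<And>u v. u \<in> K \<Longrightarrow> v \<in> K \<Longrightarrow> u \<noteq> v \<Longrightarrow> sqdist d (y u) (y v) = sqdist d (x u) (x v)"
    and x: "\<And>i. i < d \<Longrightarrow> (\<Sum>v\<in>K. c v * real (x v i)) = 0"
    and i: "i < d"
  shows "(\<Sum>v\<in>K. c v * real (y v i)) = 0"
proof -
  \<comment> \<open>For any placement \<open>z\<close> of the points, the weighted distances add up
    to \<open>-2\<close> times the squared norm of the weighted combination.\<close>
  have norm: "(\<Sum>u\<in>K. \<Sum>v\<in>K. c u * c v * of_int (sqdist d (z u) (z v))) =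
      - 2 * (\<Sum>i<d. (\<Sum>v\<in>K. c v * real (z v i))\<^sup>2)" for z
  proof -
    have "(\<Sum>u\<in>K. \<Sum>v\<in>K. c u * c v * of_int (sqdist d (z u) (z v))) =
        (\<Sum>u\<in>K. \<Sum>v\<in>K. \<Sum>i<d. c u * c v * (real (z u i) - real (z v i))\<^sup>2)"
      by (simp add: sqdist_def sum_distrib_left)
    also have "\<dots> = (\<Sum>u\<in>K. \<Sum>i<d. \<Sum>v\<in>K. c u * c v * (real (z u i) - real (z v i))\<^sup>2)"
      by (intro sum.cong refl sum.swap)
    also have "\<dots> = (\<Sum>i<d. \<Sum>u\<in>K. \<Sum>v\<in>K. c u * c v * (real (z u i) - real (z v i))\<^sup>2)"
      by (rule sum.swap)
    also have "\<dots> = (\<Sum>i<d. - 2 * (\<Sum>v\<in>K. c v * real (z v i))\<^sup>2)"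
      by (intro sum.cong refl sum_weighted_sqdiff c)
    finally show ?thesis by (simp add: sum_distrib_left)
  qed
  have "sqdist d (y u) (y v) = sqdist d (x u) (x v)" if "u \<in> K" "v \<in> K" for u v
    using dist[OF that] by (cases "u = v") (auto simp: sqdist_def)
  then have "(\<Sum>u\<in>K. \<Sum>v\<in>K. c u * c v * of_int (sqdist d (y u) (y v))) =
      (\<Sum>u\<in>K. \<Sum>v\<in>K. c u * c v * of_int (sqdist d (x u) (x v)))"
    by (intro sum.cong) auto
  \<comment> \<open>The norm vanishes for \<open>x\<close>, hence for \<open>y\<close>, and a sum of
    squares is zero only if every coordinate is.\<close>
  then have "(\<Sum>i<d. (\<Sum>v\<in>K. c v * real (y v i))\<^sup>2) = 0"
    using x unfolding norm by simp
  then show ?thesis using i by (subst (asm) sum_nonneg_eq_0_iff) auto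
qed

text \<open>Since \<open>c v0\<close> is nonzero, the relation can be solved for
  \<open>y v0\<close>. So \<open>y\<close> is determined by its values off \<open>v0\<close>, which
  saves one factor \<open>m ^ d\<close>.\<close>

lemma card_relation_le:
  fixes c :: "'a \<Rightarrow> real"
  assumes V: "finite V" "K \<subseteq> V" and v0: "v0 \<in> K" "c v0 \<noteq> 0"
  shows "card {y \<in> V \<rightarrow>\<^sub>E ({..<d} \<rightarrow>\<^sub>E {..<m}). \<forall>i<d. (\<Sum>v\<in>K. c v * real (y v i)) = 0}
    \<le> (m ^ d) ^ (card V - 1)" (is "card ?Y \<le> _")
proof -
  have K: "finite K" using V finite_subset by blast
  have "inj_on (\<lambda>y. restrict y (V - {v0})) ?Y"
  proof (rule inj_onI)
    fix y z assume y: "y \<in> ?Y" and z: "z \<in> ?Y"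
      and eq: "restrict y (V - {v0}) = restrict z (V - {v0})"
    have off: "y v = z v" if "v \<in> V" "v \<noteq> v0" for v
      using fun_cong[OF eq, of v] that by (simp add: restrict_def)
    have "y v0 i = z v0 i" if i: "i < d" for i
    proof -
      have *: "c v0 * real (w v0 i) = - (\<Sum>v\<in>K - {v0}. c v * real (w v i))" if "w \<in> ?Y" for w
        using that i sum.remove[OF K v0(1), of "\<lambda>v. c v * real (w v i)"] by auto
      have "(\<Sum>v\<in>K - {v0}. c v * real (y v i)) = (\<Sum>v\<in>K - {v0}. c v * real (z v i))"
        using off V by (intro sum.cong) auto
      then have "c v0 * real (y v0 i) = c v0 * real (z v0 i)" using *[OF y] *[OF z] by linarith
      then show ?thesis using v0 by simp
    qed
    then have "y v0 = z v0"
      using y z v0 V by (intro PiE_ext[of _ "{..<d}" "\<lambda>_. {..<m}"]) (auto simp: PiE_iff)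
    then have "y v = z v" if "v \<in> V" for v
      using off that by (cases "v = v0") auto
    then show "y = z"
      using y z by (intro PiE_ext[of _ V "\<lambda>_. {..<d} \<rightarrow>\<^sub>E {..<m}"]) auto
  qed
  moreover have "(\<lambda>y. restrict y (V - {v0})) ` ?Y \<subseteq> (V - {v0}) \<rightarrow>\<^sub>E ({..<d} \<rightarrow>\<^sub>E {..<m})"
    by (auto intro!: restrict_PiE_iff[THEN iffD2] dest: PiE_mem)
  moreover have "finite ((V - {v0}) \<rightarrow>\<^sub>E ({..<d} \<rightarrow>\<^sub>E {..<m}))"
    using V by (intro finite_PiE) auto
  ultimately have "card ?Y \<le> card ((V - {v0}) \<rightarrow>\<^sub>E ({..<d} \<rightarrow>\<^sub>E {..<m}))"
    by (rule card_inj_on_le)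
  also have "\<dots> = (m ^ d) ^ (card V - 1)"
    using V v0 by (subst card_funcsetE) (auto simp: card_funcsetE)
  finally show ?thesis .
qed

section \<open>The host graph\<close>

text \<open>The value at \<open>t\<close> of a polynomial of degree less than \<open>k\<close> with
  vector coefficients, \<open>a i j\<close> being coordinate \<open>i\<close> of coefficient
  \<open>j\<close>. There is no reduction modulo a prime, so Euclidean distances make sense.\<close>

definition codeword :: "nat \<Rightarrow> nat \<Rightarrow> (nat \<Rightarrow> nat \<Rightarrow> nat) \<Rightarrow> nat \<Rightarrow> nat \<Rightarrow> nat" where
  "codeword k d a t = (\<lambda>i\<in>{..<d}. \<Sum>j<k. a i j * t ^ j)"

lemma codeword_in_box:
  assumes a: "a \<in> {..<d} \<rightarrow>\<^sub>E ({..<k} \<rightarrow>\<^sub>E {..<m})" and "t < f" "k > 0"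
  shows "codeword k d a t \<in> {..<d} \<rightarrow>\<^sub>E {..<m * (k * f ^ k)}"
proof -
  have "(\<Sum>j<k. a i j * t ^ j) < m * (k * f ^ k)" if "i < d" for i
  proof -
    have "(\<Sum>j<k. a i j * t ^ j) < (\<Sum>j<k. m * f ^ k)"
    proof (rule sum_strict_mono)
      fix j assume "j \<in> {..<k}"
      then have "a i j < m" "j \<le> k" using a that by (auto simp: PiE_iff)
      moreover have "t ^ j \<le> f ^ j" "f ^ j \<le> f ^ k" "0 < f ^ k"
        using assms \<open>j \<le> k\<close> by (auto intro: power_mono power_increasing)
      ultimately have "a i j * t ^ j \<le> a i j * f ^ k" "a i j * f ^ k < m * f ^ k"
        by (auto intro: le_trans)
      then show "a i j * t ^ j < m * f ^ k" by linarith
    qed (use assms in auto)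
    then show ?thesis by (simp add: mult.left_commute)
  qed
  then show ?thesis by (auto simp: codeword_def)
qed

text \<open>In each coordinate the difference is a real polynomial of degree at most
  \<open>k - 1\<close> with at least \<open>k\<close> roots, hence zero.\<close>

lemma codeword_inject:
  assumes a: "a \<in> {..<d} \<rightarrow>\<^sub>E ({..<k} \<rightarrow>\<^sub>E A)" and b: "b \<in> {..<d} \<rightarrow>\<^sub>E ({..<k} \<rightarrow>\<^sub>E A)"
    and P: "k \<le> card P" and eq: "\<And>t. t \<in> P \<Longrightarrow> codeword k d a t = codeword k d b t"
  shows "a = b"
proof -
  have "a i j = b i j" if i: "i < d" and j: "j < k" for i j
  proof (rule ccontr)
    assume ne: "a i j \<noteq> b i j"
    define c where "c j = real (a i j) - real (b i j)" for j
    have k: "k > 0" using j by simp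
    have "\<exists>j\<le>k - 1. c j \<noteq> 0" using ne j by (intro exI[of _ j]) (auto simp: c_def)
    then obtain l where l: "c l \<noteq> 0" "l \<le> k - 1" by blast
    have root: "finite {z. (\<Sum>j\<le>k - 1. c j * z ^ j) = 0}"
        "card {z. (\<Sum>j\<le>k - 1. c j * z ^ j) = 0} \<le> k - 1"
      using polyfun_rootbound[of c l "k - 1"] l by auto
    have "real ` P \<subseteq> {z. (\<Sum>j\<le>k - 1. c j * z ^ j) = 0}"
    proof safe
      fix t assume "t \<in> P"
      then have "real (codeword k d a t i) = real (codeword k d b t i)" using eq by simp
      moreover have "{..k - 1} = {..<k}" using k by auto
      ultimately show "(\<Sum>j\<le>k - 1. c j * real t ^ j) = 0"
        using i by (simp add: codeword_def c_def algebra_simps sum_subtractf)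
    qed
    from card_mono[OF root(1) this] root(2) have "card (real ` P) \<le> k - 1" by linarith
    moreover have "card (real ` P) = card P" by (simp add: card_image inj_on_def)
    ultimately show False using P k by simp
  qed
  then show ?thesis
    using a b
    by (intro PiE_ext[OF a b] PiE_ext[of _ "{..<k}" "\<lambda>_. A"]) (auto simp: PiE_iff)
qed

text \<open>The factor \<open>(d * m\<^sup>2 + 1) ^ (k + 1)\<^sup>2\<close> is the number of colours
  lost to the pigeonhole. The exponent \<open>f - 1\<close> is the gain: a point above each of
  \<open>f\<close> vertices could be chosen in \<open>(m ^ d) ^ f\<close> ways.\<close>

lemma exists_host:
  fixes F :: "'a hgraph" and k d :: nat
  defines "f \<equiv> card (verts F)"
  defines "m \<equiv> d * (k * f ^ k)"
  assumes k: "k > 0" and F: "k_graph k F" and core: "is_core F"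
    and K: "is_clique K (two_shadow F)" "card K = k + 1" and d: "d > 0"
  obtains G :: "('a \<times> (nat \<Rightarrow> nat)) hgraph" and S where
    "k_graph k G" "card (verts G) = f * m ^ d" "S \<subseteq> copies F G" "edge_disjoint S"
    "d ^ (k * d) \<le> card S * (d * m\<^sup>2 + 1) ^ (k + 1)\<^sup>2"
    "card (copies F G) \<le> (m ^ d) ^ (f - 1)"
proof -
  have fin: "finite (verts F)" and edge: "\<And>e. e \<in> edges F \<Longrightarrow> e \<subseteq> verts F \<and> card e = k"
    using F by (auto simp: k_graph_def)
  have KV: "K \<subseteq> verts F" using K by (simp add: is_clique_def two_shadow_def)
  have pair: "\<exists>e\<in>edges F. u \<in> e \<and> v \<in> e" if "u \<in> K" "v \<in> K" "u \<noteq> v" for u v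
  proof -
    have "{u, v} \<in> edges (two_shadow F)" using K that by (simp add: is_clique_def)
    then show ?thesis by (auto simp: two_shadow_def doubleton_eq_iff)
  qed
  have finK: "finite K" using KV fin finite_subset by blast
  \<comment> \<open>As \<open>k > 0\<close>, the clique has two vertices, so \<open>F\<close> has an
    edge. This edge later shows that distinct polynomials give distinct copies.\<close>
  obtain u0 v0 where "u0 \<in> K" "v0 \<in> K" "u0 \<noteq> v0"
    using K(2) k finK card_le_Suc0_iff_eq[of K] by auto
  with pair obtain e0 where e0: "e0 \<in> edges F" by blast
  obtain p where "bij_betw p (verts F) {0..<f}"
    unfolding f_def using ex_bij_betw_finite_nat[OF fin] by blast
  then have p: "inj_on p (verts F)" "\<And>v. v \<in> verts F \<Longrightarrow> p v < f"
    by (auto simp: bij_betw_def)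
  define A where "A = {..<d} \<rightarrow>\<^sub>E ({..<k} \<rightarrow>\<^sub>E {..<d})"
  define Box where "Box = {..<d} \<rightarrow>\<^sub>E {..<m}"
  define X where "X a v = codeword k d a (p v)" for a v
  have XBox: "X a v \<in> Box" if "a \<in> A" "v \<in> verts F" for a v
    using codeword_in_box[of a d k d "p v" f] p(2) that k
    by (simp add: X_def Box_def m_def A_def)
  \<comment> \<open>An edge supplies \<open>k\<close> distinct evaluation points, enough to
    determine the polynomial.\<close>
  have X_inject: "a = b" if "a \<in> A" "b \<in> A" "e \<in> edges F" "\<And>v. v \<in> e \<Longrightarrow> X a v = X b v" for a b e
  proof (rule codeword_inject[of a d k "{..<d}" b "p ` e"])
    have "card (p ` e) = k" using edge[OF that(3)] p(1) by (metis card_image inj_on_subset)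
    then show "k \<le> card (p ` e)" by simp
  qed (use that in \<open>auto simp: A_def X_def\<close>)
  define color where "color a = (\<lambda>(u, v)\<in>K \<times> K. sqdist d (X a u) (X a v))" for a
  define Colors where "Colors = K \<times> K \<rightarrow>\<^sub>E {0..int (d * m\<^sup>2)}"
  have "sqdist d (X a u) (X a v) \<in> {0..int (d * m\<^sup>2)}" if "a \<in> A" "u \<in> K" "v \<in> K" for a u v
    using XBox KV that by (intro sqdist_bounds) (auto simp: Box_def)
  then have "color \<in> A \<rightarrow> Colors"
    unfolding color_def Colors_def by (auto simp del: of_nat_mult of_nat_power split: if_splits)
  moreover have "finite A" "finite Colors"
    unfolding A_def Colors_def using finK by (auto intro!: finite_PiE)
  moreover have "Colors \<noteq> {}" by (simp add: Colors_def PiE_eq_empty_iff)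
  ultimately obtain D where D: "card A \<le> card (color -` {D} \<inter> A) * card Colors"
    using pigeonhole_card by blast
  define A' where "A' = color -` {D} \<inter> A"
  have cardA: "card A = d ^ (k * d)"
    unfolding A_def by (subst card_funcsetE) (simp_all add: card_funcsetE power_mult)
  have cardColors: "card Colors = (d * m\<^sup>2 + 1) ^ (k + 1)\<^sup>2"
    unfolding Colors_def using finK K(2)
    by (subst card_funcsetE) (simp_all add: card_cartesian_product power2_eq_square nat_add_distrib nat_mult_distrib)
  have A'A: "a \<in> A" if "a \<in> A'" for a using that by (simp add: A'_def)
  have "A' \<noteq> {}"
    using D d cardA unfolding A'_def[symmetric] by auto
  \<comment> \<open>Any surviving polynomial can serve as reference, since all of \<open>A'\<close>
    share the same distances above \<open>K\<close>.\<close>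
  then obtain a0 where a0: "a0 \<in> A'" by blast
  define G where "G = lift_union F Box (X ` A')"
  define S where "S = (\<lambda>a. lift_along (X a) F) ` A'"
  \<comment> \<open>A single common edge identifies the polynomials. This gives both the
    edge-disjointness of \<open>S\<close> and its cardinality.\<close>
  have same: "a = b" if ab: "a \<in> A'" "b \<in> A'" "E \<in> edges (lift_along (X a) F)" "E \<in> edges (lift_along (X b) F)"
    for a b E
  proof -
    obtain e where e: "e \<in> edges F" "E = (\<lambda>v. (v, X a v)) ` e"
      using ab(3) unfolding lift_along_def hgraph_image_def snd_conv by (elim imageE)
    obtain e' where e': "E = (\<lambda>v. (v, X b v)) ` e'"
      using ab(4) unfolding lift_along_def hgraph_image_def snd_conv by (elim imageE)
    show ?thesis
      using e' by (intro X_inject[OF A'A[OF ab(1)] A'A[OF ab(2)] e(1)] lift_edge_eqD(2)) (simp_all add: e(2))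
  qed
  have "inj_on (\<lambda>a. lift_along (X a) F) A'"
  proof (rule inj_onI)
    fix a b assume *: "a \<in> A'" "b \<in> A'" "lift_along (X a) F = lift_along (X b) F"
    have "(\<lambda>v. (v, X a v)) ` e0 \<in> edges (lift_along (X a) F)"
      using e0 by (simp add: lift_along_def hgraph_image_def)
    then show "a = b" using same * by metis
  qed
  then have cardS: "card S = card A'" by (simp add: S_def card_image)
  show ?thesis
  proof (rule that)
    have cardBox: "card Box = m ^ d" by (simp add: Box_def card_funcsetE)
    have finBox: "finite Box" by (auto simp: Box_def intro: finite_PiE)
    have XT: "x v \<in> Box" if "x \<in> X ` A'" "v \<in> verts F" for x v using that XBox A'A by auto
    show "k_graph k G" unfolding G_def by (rule k_graph_lift_union[OF F finBox]) (use XT in blast)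
    show "card (verts G) = f * m ^ d"
      by (simp add: G_def lift_union_def card_cartesian_product cardBox f_def)
    show "S \<subseteq> copies F G"
      unfolding S_def G_def
      by (intro image_subsetI lift_along_copy[OF F] imageI) (use XT in blast)
    show "edge_disjoint S"
      unfolding edge_disjoint_def pairwise_def S_def using same by blast
    show "d ^ (k * d) \<le> card S * (d * m\<^sup>2 + 1) ^ (k + 1)\<^sup>2"
      using D unfolding cardA cardColors cardS A'_def .
    have inj: "inj_on (\<lambda>v. real (p v)) K" using p(1) KV by (auto simp: inj_on_def)
    then have "card (real ` p ` K) = Suc k" using K(2) by (simp add: image_image card_image)
    then obtain c where c: "\<exists>t\<in>real ` p ` K. c t \<noteq> 0"
      "\<And>j. j < k \<Longrightarrow> (\<Sum>t\<in>real ` p ` K. c t * t ^ j) = 0"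
      using moment_relation[of "real ` p ` K" k] finK by blast
    define w where "w v = c (real (p v))" for v
    have w: "(\<Sum>v\<in>K. w v * real (p v) ^ j) = 0" if "j < k" for j
      using c(2)[OF that] inj by (simp add: sum.reindex image_image w_def)
    obtain v1 where v1: "v1 \<in> K" "w v1 \<noteq> 0" using c(1) by (auto simp: w_def)
    \<comment> \<open>Each coordinate of \<open>X a0 v\<close> is a polynomial in \<open>p v\<close>
      of degree less than \<open>k\<close>, so the weights annihilate it.\<close>
    have rel: "(\<Sum>v\<in>K. w v * real (X a0 v i)) = 0" if "i < d" for i
    proof -
      have "(\<Sum>v\<in>K. w v * real (X a0 v i)) =
          (\<Sum>v\<in>K. \<Sum>j<k. real (a0 i j) * (w v * real (p v) ^ j))"
        using that by (simp add: X_def codeword_def sum_distrib_left mult_ac)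
      also have "\<dots> = (\<Sum>j<k. real (a0 i j) * (\<Sum>v\<in>K. w v * real (p v) ^ j))"
        by (subst sum.swap) (simp add: sum_distrib_left)
      finally show ?thesis using w by simp
    qed
    define Y where "Y = {y \<in> verts F \<rightarrow>\<^sub>E ({..<d} \<rightarrow>\<^sub>E {..<m}). \<forall>i<d. (\<Sum>v\<in>K. w v * real (y v i)) = 0}"
    have "copies F G \<subseteq> (\<lambda>y. lift_along y F) ` Y"
    proof
      fix H assume "H \<in> copies F G"
      then obtain y where y: "y \<in> verts F \<rightarrow>\<^sub>E Box" "H = lift_along y F"
        and local: "\<And>e. e \<in> edges F \<Longrightarrow> \<exists>x\<in>X ` A'. \<forall>v\<in>e. y v = x v"
        unfolding G_def using copies_lift_unionE[OF F core] by metis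
      have "(\<Sum>v\<in>K. w v * real (y v i)) = 0" if "i < d" for i
      proof (rule affine_relation_transfer[OF _ _ rel that])
        show "(\<Sum>v\<in>K. w v) = 0" using w[of 0] k by simp
        fix u v assume uv: "u \<in> K" "v \<in> K" "u \<noteq> v"
        \<comment> \<open>The clique property enters here: \<open>u\<close> and \<open>v\<close>
          share an edge of \<open>F\<close>, on which \<open>y\<close> agrees with one
          \<open>X a\<close>, and the colour of \<open>a\<close> fixes the distance.\<close>
        then obtain e where e: "e \<in> edges F" "u \<in> e" "v \<in> e" using pair by blast
        then obtain a where a: "a \<in> A'" "y u = X a u" "y v = X a v" using local by blast
        have "color a = color a0" using a(1) a0 by (simp add: A'_def)
        then have "color a (u, v) = color a0 (u, v)" by simp
        then show "sqdist d (y u) (y v) = sqdist d (X a0 u) (X a0 v)"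
          using a uv by (simp add: color_def)
      qed
      then show "H \<in> (\<lambda>y. lift_along y F) ` Y" using y by (auto simp: Y_def Box_def)
    qed
    moreover have "finite Y"
      unfolding Y_def using fin by (intro finite_subset[OF Collect_restrict] finite_PiE) (auto intro: finite_PiE)
    ultimately have "card (copies F G) \<le> card Y" by (rule surj_card_le[rotated])
    also have "\<dots> \<le> (m ^ d) ^ (f - 1)"
      unfolding Y_def f_def using fin KV v1 by (rule card_relation_le)
    finally show "card (copies F G) \<le> (m ^ d) ^ (f - 1)" .
  qed
qed

section \<open>Comparison of growth rates and conclusion\<close>

lemma exponential_lt_superexponential:
  fixes c C :: real and f k q L :: nat
  assumes c: "c > 0" and f: "f > 0" and L: "L > 0"
  obtains d :: nat where "d > 0"
    "(real (d * (d * L)\<^sup>2 + 1) ^ q * real f ^ k * real L ^ (k * d)) powr C < c * real f * real (d * L) ^ d"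
proof -
  define l where "l = real L"
  define r where "r = k * ln (real f)"
  define s where "s = ln c + ln (real f)"
  define b where "b = k * ln l"
  have l: "l > 0" using L by (simp add: l_def)
  \<comment> \<open>This is the difference of the logarithms of the two sides: the positive part
    grows like \<open>d * ln d\<close>, while the subtracted part is of order at most
    \<open>d\<close>.\<close>
  have "filterlim (\<lambda>d::nat. s + real d * ln (real d * l) -
      C * (real q * ln (real d * (real d * l)\<^sup>2 + 1) + r + real d * b)) at_top at_top"
    using l by real_asymp
  then have "eventually (\<lambda>d::nat. s + real d * ln (real d * l) -
      C * (real q * ln (real d * (real d * l)\<^sup>2 + 1) + r + real d * b) > 0) at_top"
    by (rule filterlim_at_top_dense[THEN iffD1, rule_format])
  then have "eventually (\<lambda>d::nat. d > 0 \<and> s + real d * ln (real d * l) -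
      C * (real q * ln (real d * (real d * l)\<^sup>2 + 1) + r + real d * b) > 0) at_top"
    by (intro eventually_conj eventually_gt_at_top)
  then obtain d :: nat where d: "d > 0" and gt:
      "C * (real q * ln (real d * (real d * l)\<^sup>2 + 1) + r + real d * b) < s + real d * ln (real d * l)"
    using eventually_happens'[OF sequentially_bot] by auto
  let ?x = "real (d * (d * L)\<^sup>2 + 1) ^ q * real f ^ k * real L ^ (k * d)"
  let ?y = "c * real f * real (d * L) ^ d"
  have pos: "?x > 0" "?y > 0" using assms d by (auto intro!: mult_pos_pos add_pos_nonneg zero_less_power)
  have B: "real (d * (d * L)\<^sup>2 + 1) > 0" unfolding of_nat_0_less_iff by simp
  have "ln ?x = real q * ln (real (d * (d * L)\<^sup>2 + 1)) + k * ln (real f) + (k * d) * ln (real L)"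
    using f L B by (simp add: ln_mult ln_realpow del: of_nat_add of_nat_mult of_nat_power)
  then have lx: "ln ?x = real q * ln (real d * (real d * l)\<^sup>2 + 1) + r + real d * b"
    by (simp add: l_def r_def b_def add.commute)
  have "ln ?y = ln c + ln (real f) + d * ln (real (d * L))"
    using c f L d by (simp add: ln_mult ln_realpow del: of_nat_add of_nat_mult of_nat_power)
  then have ly: "ln ?y = s + real d * ln (real d * l)"
    by (simp add: l_def s_def)
  have "ln (?x powr C) < ln ?y" using gt unfolding lx[symmetric] ly[symmetric] ln_powr .
  moreover have "?x powr C > 0"
    unfolding powr_gt_zero by (rule less_imp_neq[OF pos(1), symmetric])
  ultimately have "?x powr C < ?y" using pos(2) by (simp only: ln_less_cancel_iff)
  then show ?thesis using d that by blast
qed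

theorem lemma1p2:
  fixes k :: nat and F :: "'a hgraph"
  assumes "k \<ge> 2"
    and "k_graph k F"
    and "is_core F"
    and "\<exists>K. is_clique K (two_shadow F) \<and> card K = k + 1"
  shows "\<not> polynomial_removal k F"
proof
  assume "polynomial_removal k F"
  then obtain c C :: real where c: "c > 0" and removal:
    "\<And>(\<epsilon> :: real) (G :: ('a \<times> (nat \<Rightarrow> nat)) hgraph) S. 0 < \<epsilon> \<Longrightarrow> \<epsilon> < 1 \<Longrightarrow> k_graph k G \<Longrightarrow> verts G \<noteq> {} \<Longrightarrow>
       S \<subseteq> copies F G \<Longrightarrow> edge_disjoint S \<Longrightarrow> \<epsilon> * real (card (verts G)) ^ k \<le> real (card S) \<Longrightarrow>
       c * \<epsilon> powr C * real (card (verts G)) ^ card (verts F) \<le> real (card (copies F G))"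
    by (rule polynomial_removal_host) blast
  obtain K where K: "is_clique K (two_shadow F)" "card K = k + 1" using assms(4) by blast
  define f where "f = card (verts F)"
  define L where "L = k * f ^ k"
  define q where "q = (k + 1)\<^sup>2"
  have k: "k > 0" using assms(1) by simp
  have "K \<subseteq> verts F" using K by (simp add: is_clique_def two_shadow_def)
  then have f: "f > 0"
    using card_mono[of "verts F" K] K assms(2) by (simp add: f_def k_graph_def)
  have L: "L > 0" using f k by (simp add: L_def)
  obtain d where d: "d > 0" and lt:
    "(real (d * (d * L)\<^sup>2 + 1) ^ q * real f ^ k * real L ^ (k * d)) powr C < c * real f * real (d * L) ^ d"
    by (rule exponential_lt_superexponential[OF c f L])
  obtain G :: "('a \<times> (nat \<Rightarrow> nat)) hgraph" and S where
    G: "k_graph k G" "card (verts G) = f * (d * L) ^ d" and S: "S \<subseteq> copies F G" "edge_disjoint S"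
    and large: "d ^ (k * d) \<le> card S * (d * (d * L)\<^sup>2 + 1) ^ q"
    and few: "card (copies F G) \<le> ((d * L) ^ d) ^ (f - 1)"
    using exists_host[OF k assms(2,3) K d] unfolding f_def L_def q_def by metis
  define B where "B = real (d * (d * L)\<^sup>2 + 1)"
  define N where "N = real (d * L) ^ d"
  \<comment> \<open>The density is taken as \<open>1 / Q\<close>. The host has
    \<open>f * (d * L) ^ d\<close> vertices, so \<open>Q\<close> collects the factors of its
    \<open>k\<close>-th power other than \<open>d ^ (k * d)\<close>, together with the pigeonhole
    loss \<open>B ^ q\<close>.\<close>
  define Q where "Q = B ^ q * real f ^ k * real L ^ (k * d)"
  have N: "N > 0" using d L by (simp add: N_def)
  \<comment> \<open>Strictness is what makes \<open>1 / Q\<close> an admissible density below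
    1.\<close>
  have "1 < B" using d L by (simp add: B_def)
  then have "1 < B ^ q" by (simp add: q_def one_less_power)
  moreover have "1 \<le> real f ^ k" "1 \<le> real L ^ (k * d)" using f L by (auto intro!: one_le_power)
  ultimately have Q: "1 < Q"
    unfolding Q_def by (smt (verit) mult_less_cancel_left1 mult_le_cancel_left1)
  have "(1 / Q) * real (card (verts G)) ^ k \<le> real (card S)"
  proof -
    have "real (card (verts G)) ^ k = real f ^ k * real L ^ (k * d) * real d ^ (k * d)"
      by (simp add: G(2) power_mult_distrib mult_ac flip: power_mult)
    also have "real d ^ (k * d) \<le> real (card S) * B ^ q"
      using large unfolding B_def by (metis of_nat_le_iff of_nat_mult of_nat_power)
    finally have "real (card (verts G)) ^ k \<le> real f ^ k * real L ^ (k * d) * (real (card S) * B ^ q)"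
      by (simp add: mult_left_mono)
    then show ?thesis using Q by (simp add: Q_def divide_simps mult_ac)
  qed
  moreover have "verts G \<noteq> {}" using G(2) f d L by auto
  ultimately have "c * (1 / Q) powr C * real (card (verts G)) ^ f \<le> real (card (copies F G))"
    unfolding f_def using Q G(1) S by (intro removal) auto
  also have "\<dots> \<le> N ^ (f - 1)"
    using few unfolding N_def by (metis of_nat_le_iff of_nat_power)
  finally have "c * (1 / Q) powr C * (real f * N) ^ f \<le> N ^ (f - 1)"
    by (simp add: G(2) N_def)
  moreover have "real f * N ^ f \<le> (real f * N) ^ f"
    using f N by (simp add: power_mult_distrib self_le_power)
  ultimately have "c * (1 / Q) powr C * (real f * N ^ f) \<le> N ^ (f - 1)"
    using c by (smt (verit) mult_left_mono mult_nonneg_nonneg powr_ge_zero)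
  moreover have "N ^ f = N * N ^ (f - 1)" using f by (simp add: power_eq_if)
  \<comment> \<open>Cancelling \<open>N ^ (f - 1)\<close> leaves one factor
    \<open>N = (d * L) ^ d\<close>, which by the choice of \<open>d\<close> is too large for
    \<open>Q powr C\<close>.\<close>
  ultimately have "(c * (1 / Q) powr C * (real f * N)) * N ^ (f - 1) \<le> 1 * N ^ (f - 1)"
    by (simp add: mult_ac)
  then have "c * (1 / Q) powr C * (real f * N) \<le> 1"
    using N by (subst (asm) mult_le_cancel_right) auto
  then have "c * real f * N \<le> Q powr C"
    using Q by (simp add: powr_divide field_simps)
  with lt show False by (simp add: Q_def B_def N_def)
qed

end
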